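(* Let $A=P-R+S$ be a double proper weak splitting of type I of $A\in\mathbb{R}^{m\times n}$ with $A^\dagger P\ge 0$. For $\lambda>0$, let $B_\lambda=A^TA+\lambda I\in\mathbb{R}^{n\times n}$ and let $B_\lambda=P_\lambda-R_\lambda+S_\lambda$ be a double weak splitting of type I with $B_\lambda^{-1}P_\lambda\ge 0$. Put $$\mathbf{W}=\begin{pmatrix}P^\dagger R & -P^\dagger S\\ I & 0\end{pmatrix},\qquad \mathbf{W}_\lambda=\begin{pmatrix}P_\lambda^{-1}R_\lambda & -P_\lambda^{-1}S_\lambda\\ I & 0\end{pmatrix}.$$ If any one of the following conditions holds: (i) $P^\dagger R\ge\lim_{\lambda\to 0}P_\lambda^{-1}R_\lambda$ and $\lim_{\lambda\to 0}P_\lambda^{-1}S_\lambda\ge P^\dagger S$, (ii) $P^\dagger(R-S)\ge I$, then $\lim_{\lambda\to 0}\rho(\mathbf{W}_\lambda)\le\rho(\mathbf{W})<1$.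
   Context: Matrix inequalities are entrywise; $X^\dagger$ is the Moore-Penrose inverse; $\rho$ is the spectral radius; $I$ is the $n\times n$ identity. A decomposition $A=P-R+S$ of $A\in\mathbb{R}^{m\times n}$ is a double proper weak splitting of type I if $A$ and $P$ have the same range and the same null space, $P^\dagger R\ge 0$ and $P^\dagger S\le 0$. For nonsingular $B\in\mathbb{R}^{n\times n}$, a decomposition $B=P-R+S$ with $P$ nonsingular is a double weak splitting of type I if $P^{-1}R\ge 0$ and $-P^{-1}S\ge 0$. $\lim_{\lambda\to0}$ denotes the limit as $\lambda\to 0$ through positive values (entrywise for matrices). *)

theory Defs
  imports "Jordan_Normal_Form.Spectral_Radius" "Jordan_Normal_Form.Matrix_Kernel"
begin

definition is_moore_penrose :: "real mat \<Rightarrow> real mat \<Rightarrow> bool" where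
  "is_moore_penrose A X \<longleftrightarrow>
     X \<in> carrier_mat (dim_col A) (dim_row A) \<and>
     A * X * A = A \<and> X * A * X = X \<and>
     transpose_mat (A * X) = A * X \<and> transpose_mat (X * A) = X * A"

definition pinv :: "real mat \<Rightarrow> real mat" where
  "pinv A = (THE X. is_moore_penrose A X)"

text \<open>Meaningful for nonsingular matrices only.\<close>
definition minv :: "real mat \<Rightarrow> real mat" where
  "minv A = the (mat_inverse A)"

definition mat_range :: "real mat \<Rightarrow> real vec set" where
  "mat_range A = {A *\<^sub>v x | x. x \<in> carrier_vec (dim_col A)}"

text \<open>The order on \<open>mat\<close> is entrywise between matrices of equal dimensions.\<close>

definition double_proper_weak_splitting_I ::
  "nat \<Rightarrow> nat \<Rightarrow> real mat \<Rightarrow> real mat \<Rightarrow> real mat \<Rightarrow> real mat \<Rightarrow> bool" where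
  "double_proper_weak_splitting_I m n A P R S \<longleftrightarrow>
     A \<in> carrier_mat m n \<and> P \<in> carrier_mat m n \<and> R \<in> carrier_mat m n \<and> S \<in> carrier_mat m n \<and>
     A = P - R + S \<and>
     mat_range A = mat_range P \<and> mat_kernel A = mat_kernel P \<and>
     pinv P * R \<ge> 0\<^sub>m n n \<and> pinv P * S \<le> 0\<^sub>m n n"

definition double_weak_splitting_I ::
  "nat \<Rightarrow> real mat \<Rightarrow> real mat \<Rightarrow> real mat \<Rightarrow> real mat \<Rightarrow> bool" where
  "double_weak_splitting_I n B P R S \<longleftrightarrow>
     B \<in> carrier_mat n n \<and> P \<in> carrier_mat n n \<and> R \<in> carrier_mat n n \<and> S \<in> carrier_mat n n \<and>
     invertible_mat B \<and> invertible_mat P \<and>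
     B = P - R + S \<and>
     minv P * R \<ge> 0\<^sub>m n n \<and> - (minv P * S) \<ge> 0\<^sub>m n n"

definition double_iteration_mat :: "nat \<Rightarrow> real mat \<Rightarrow> real mat \<Rightarrow> real mat" where
  "double_iteration_mat n G H = four_block_mat G (- H) (1\<^sub>m n) (0\<^sub>m n n)"

text \<open>Spectral radius of a real matrix: the maximal modulus of its complex eigenvalues.\<close>
definition real_spectral_radius :: "real mat \<Rightarrow> real" where
  "real_spectral_radius A = spectral_radius (map_mat complex_of_real A)"

text \<open>Entrywise convergence; the family is required to have the dimensions of the limit
  eventually along the filter.\<close>
definition mat_tendsto :: "('b \<Rightarrow> real mat) \<Rightarrow> real mat \<Rightarrow> 'b filter \<Rightarrow> bool" where
  "mat_tendsto f L F \<longleftrightarrow>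
     eventually (\<lambda>x. f x \<in> carrier_mat (dim_row L) (dim_col L)) F \<and>
     (\<forall>i < dim_row L. \<forall>j < dim_col L. ((\<lambda>x. f x $$ (i, j)) \<longlongrightarrow> L $$ (i, j)) F)"

end

theory Submission
  imports Defs
begin

text \<open>Write \<open>G = P\<^sup>\<dagger>R\<close>, \<open>H = P\<^sup>\<dagger>S\<close> and \<open>T = G - H \<ge> 0\<close>. The matrix
  \<open>A\<^sup>\<dagger>P \<ge> 0\<close> yields a positive vector \<open>u\<close> with \<open>T u = u - e\<close>. Hence condition (ii), which
  says \<open>T \<ge> I\<close>, is never satisfied, and a perturbation of \<open>(u, u)\<close> is strictly decreased by
  \<open>W\<close>, so that \<open>\<rho>(W) < 1\<close>. Under condition (i) the matrices \<open>W\<^sub>\<lambda>\<close> converge to a nonnegative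
  matrix that is entrywise at most \<open>W\<close>, and the spectral radius is continuous and monotone
  on nonnegative matrices: upper bounds are certified by positive vectors \<open>z\<close> with
  \<open>A z < c z\<close>, which survive small perturbations, and lower bounds by the factorization of the
  characteristic polynomial, whose value at an eigenvalue of the limit tends to zero.\<close>

section \<open>Moore-Penrose inverses\<close>

text \<open>Equations between dimensions replace carrier sets, so that the simplifier can discharge
  the side conditions without instantiating dimension variables.\<close>

lemma assoc_mult_mat_dim:
  assumes "dim_col A = dim_row B" "dim_col B = dim_row C"
  shows "(A * B) * C = A * (B * (C :: 'a :: semiring_0 mat))"
  by (rule assoc_mult_mat[of _ "dim_row A" "dim_col A" _ "dim_col B" _ "dim_col C"])
    (use assms in auto)

lemma transpose_mult_dim:
  assumes "dim_col A = dim_row B"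
  shows "transpose_mat (A * B) = transpose_mat B * transpose_mat (A :: 'a :: comm_semiring_0 mat)"
  by (rule transpose_mult[of _ "dim_row A" "dim_col A" _ "dim_col B"]) (use assms in auto)

lemma index_mult_mat_sum:
  "i < dim_row A \<Longrightarrow> j < dim_col B \<Longrightarrow> dim_col A = dim_row B \<Longrightarrow>
    (A * B) $$ (i,j) = (\<Sum>k = 0..<dim_row B. A $$ (i,k) * B $$ (k,j))"
  by (auto simp: scalar_prod_def intro!: sum.cong)

lemma minus_self_mat: "A \<in> carrier_mat m n \<Longrightarrow> A - A = 0\<^sub>m m (n :: nat)"
  for A :: "'a :: group_add mat"
  by (intro eq_matI) auto

lemma mat_eq_if_minus_eq_0:
  fixes A B :: "'a :: group_add mat"
  assumes "A \<in> carrier_mat m n" "B \<in> carrier_mat m n" "A - B = 0\<^sub>m m n"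
  shows "A = B"
proof (intro eq_matI)
  fix i j assume "i < dim_row B" "j < dim_col B"
  moreover from this assms(1,2) have "(A - B) $$ (i,j) = A $$ (i,j) - B $$ (i,j)" by simp
  ultimately show "A $$ (i,j) = B $$ (i,j)" using assms by simp
qed (use assms in auto)

lemma mat_eq_if_mult_vec_eq:
  fixes A B :: "'a :: semiring_1 mat"
  assumes A: "A \<in> carrier_mat m n" and B: "B \<in> carrier_mat m n"
    and eq: "\<And>v. v \<in> carrier_vec n \<Longrightarrow> A *\<^sub>v v = B *\<^sub>v v"
  shows "A = B"
proof (intro eq_matI)
  fix i j assume "i < dim_row B" "j < dim_col B"
  moreover from this B have "A *\<^sub>v unit_vec n j = B *\<^sub>v unit_vec n j" by (intro eq) auto
  then have "(A *\<^sub>v unit_vec n j) $ i = (B *\<^sub>v unit_vec n j) $ i" by simp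
  ultimately show "A $$ (i,j) = B $$ (i,j)" using A B by simp
qed (use A B in auto)

section \<open>Gram matrices; existence and uniqueness of the Moore-Penrose inverse\<close>

text \<open>The diagonal entry at \<open>j\<close> of the Gram matrix is the sum of the squares of
  column \<open>j\<close>, so its vanishing kills every real entry of that column.\<close>

lemma gram_eq_0:
  fixes Z :: "real mat"
  assumes Z: "Z \<in> carrier_mat m n" and 0: "transpose_mat Z * Z = 0\<^sub>m n n"
  shows "Z = 0\<^sub>m m n"
proof (intro eq_matI)
  fix i j assume "i < dim_row (0\<^sub>m m n :: real mat)" "j < dim_col (0\<^sub>m m n :: real mat)"
  then have i: "i < m" and j: "j < n" by auto
  have "(transpose_mat Z * Z) $$ (j,j) = (\<Sum>k = 0..<m. (Z $$ (k,j))\<^sup>2)"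
    using Z j by (auto simp: scalar_prod_def power2_eq_square intro!: sum.cong)
  then have "(\<Sum>k = 0..<m. (Z $$ (k,j))\<^sup>2) = 0" using 0 j by simp
  then show "Z $$ (i,j) = 0\<^sub>m m n $$ (i,j)"
    using i j by (subst (asm) sum_nonneg_eq_0_iff) auto
qed (use Z in auto)

text \<open>The columns of \<open>D = A * Y - A * Z\<close> lie in the range of \<open>A\<close> and
  are annihilated by the transpose of \<open>A\<close>, so the Gram matrix of \<open>D\<close> is
  zero.\<close>

lemma gram_cancel:
  fixes A Y Z :: "real mat"
  assumes A: "A \<in> carrier_mat m n" and Y: "Y \<in> carrier_mat n k" and Z: "Z \<in> carrier_mat n k"
    and eq: "transpose_mat A * A * Y = transpose_mat A * A * Z"
  shows "A * Y = A * Z"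
proof -
  let ?D = "A * Y - A * Z"
  have D: "?D \<in> carrier_mat m k" using A Y Z by auto
  have "?D = A * (Y - Z)" by (rule mult_minus_distrib_mat[symmetric]) (use A Y Z in auto)
  then have "transpose_mat ?D * ?D = transpose_mat (Y - Z) * transpose_mat A * ?D"
    using A Y Z by (simp add: transpose_mult_dim)
  also have "\<dots> = transpose_mat (Y - Z) * (transpose_mat A * ?D)"
    using A Y Z by (simp add: assoc_mult_mat_dim)
  also have "transpose_mat A * ?D = transpose_mat A * (A * Y) - transpose_mat A * (A * Z)"
    by (rule mult_minus_distrib_mat) (use A Y Z in auto)
  also have "\<dots> = 0\<^sub>m n k"
    using eq A Y Z by (simp add: assoc_mult_mat_dim minus_self_mat[of _ n k])
  finally have "transpose_mat ?D * ?D = 0\<^sub>m k k" using Y Z by simp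
  then have "?D = 0\<^sub>m m k" by (rule gram_eq_0[OF D])
  then show ?thesis by (rule mat_eq_if_minus_eq_0[rotated 2]) (use A Y Z in auto)
qed

text \<open>A row echelon form \<open>C\<close> has the inner inverse \<open>E\<close> that sends row \<open>i\<close> to its pivot column;
  the general case is \<open>A = Q * C\<close> with \<open>Q\<close> invertible.\<close>

lemma inner_inverse_exists:
  fixes A :: "'a :: field mat"
  assumes A: "A \<in> carrier_mat m n"
  obtains G where "G \<in> carrier_mat n m" "A * G * A = A"
proof -
  obtain C where C_def: "gauss_jordan_single A = C" by simp
  note gj = gauss_jordan_single[OF A C_def]
  have C: "C \<in> carrier_mat m n" by (rule gj(2))
  obtain P Q where PQ: "C = P * A" "P \<in> carrier_mat m m" "Q \<in> carrier_mat m m" "Q * P = 1\<^sub>m m"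
    using gj(4) by auto
  obtain f where f: "pivot_fun C f n" using gj(3) C unfolding row_echelon_form_def by auto
  have dC: "dim_row C = m" using C by auto
  note piv = pivot_funD[OF dC f]
  \<comment> \<open>A zero row has \<open>f i = n\<close>, which no \<open>j < n\<close> equals, so
    its column of \<open>E\<close> is zero.\<close>
  define E :: "'a mat" where "E = mat n m (\<lambda>(j,i). if f i = j then 1 else 0)"
  have E: "E \<in> carrier_mat n m" unfolding E_def by simp
  \<comment> \<open>Pivot columns of \<open>C\<close> are unit vectors, so \<open>C * E\<close> is
    the diagonal 0/1 matrix that keeps exactly the nonzero rows of \<open>C\<close>.\<close>
  have CE: "(C * E) $$ (i,k) = (if i = k \<and> f k < n then 1 else 0)" if "i < m" "k < m" for i k
  proof -
    have "(C * E) $$ (i,k) = (\<Sum>j = 0..<n. C $$ (i,j) * (if f k = j then 1 else 0))"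
      using that C by (auto simp: E_def scalar_prod_def intro!: sum.cong)
    also have "\<dots> = (\<Sum>j = 0..<n. if f k = j then C $$ (i,j) else 0)"
      by (intro sum.cong) auto
    also have "\<dots> = (if i = k \<and> f k < n then 1 else 0)"
      using piv(4)[of k] piv(5)[of k i] that by auto
    finally show ?thesis .
  qed
  have CEC: "C * E * C = C"
  proof (intro eq_matI)
    fix i l assume "i < dim_row C" "l < dim_col C"
    then have i: "i < m" and l: "l < n" using C by auto
    have "(C * E * C) $$ (i,l) = (\<Sum>k = 0..<m. (C * E) $$ (i,k) * C $$ (k,l))"
      using i l C E by (subst index_mult_mat_sum) auto
    also have "\<dots> = (\<Sum>k = 0..<m. if i = k then (if f k < n then C $$ (k,l) else 0) else 0)"
      by (intro sum.cong) (auto simp: CE i)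
    also have "\<dots> = (if f i < n then C $$ (i,l) else 0)" using i by simp
    also have "\<dots> = C $$ (i,l)" using piv(1)[OF i] piv(2)[OF i, of l] l by auto
    finally show "(C * E * C) $$ (i,l) = C $$ (i,l)" .
  qed (use C E in auto)
  have QC: "A = Q * C"
    using PQ A by (simp add: assoc_mult_mat_dim[symmetric])
  have "A * (E * P) * A = Q * (C * E * C)"
    using PQ A E QC C by (simp add: assoc_mult_mat_dim)
  then have "A * (E * P) * A = A" using CEC QC by simp
  moreover have "E * P \<in> carrier_mat n m" using E PQ by auto
  ultimately show ?thesis using that by blast
qed

text \<open>For an inner inverse \<open>G\<close> of the Gram matrix \<open>A\<^sup>T * A\<close>,
  take \<open>L = G * A\<^sup>T\<close>. Cancelling the left factor \<open>A\<^sup>T\<close> in the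
  inner-inverse equation gives \<open>A * L * A = A\<close>.\<close>

lemma left_symmetric_inverse_exists:
  fixes A :: "real mat"
  assumes A: "A \<in> carrier_mat m n"
  obtains L where "L \<in> carrier_mat n m" "A * L * A = A" "transpose_mat (A * L) = A * L"
proof -
  let ?T = "transpose_mat A"
  obtain G where G: "G \<in> carrier_mat n n" and GG: "?T * A * G * (?T * A) = ?T * A"
    using inner_inverse_exists[of "?T * A" n n] A by auto
  have "A * (G * (?T * A)) = A * 1\<^sub>m n"
    by (rule gram_cancel[OF A])
      (use A G GG in \<open>auto simp: assoc_mult_mat_dim\<close>)
  then have 1: "A * (G * (?T * A)) = A" using A by simp
  have "transpose_mat (A * (G * (?T * A))) = ?T" by (simp only: 1)
  then have 2: "?T * (A * (transpose_mat G * ?T)) = ?T"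
    using A G by (simp add: transpose_mult_dim assoc_mult_mat_dim)
  \<comment> \<open>Although \<open>G\<close> need not be symmetric, inserting the transposed
    equation shows that it may be replaced by its transpose between \<open>A\<close> and
    \<open>?T\<close>, which is the required symmetry.\<close>
  have "A * (G * ?T) = A * (G * (?T * (A * (transpose_mat G * ?T))))" by (simp only: 2)
  also have "\<dots> = A * (G * (?T * A)) * (transpose_mat G * ?T)"
    using A G by (simp add: assoc_mult_mat_dim)
  also have "\<dots> = A * (transpose_mat G * ?T)" by (simp only: 1)
  finally have "transpose_mat (A * (G * ?T)) = A * (G * ?T)"
    using A G by (simp add: transpose_mult_dim assoc_mult_mat_dim)
  moreover have "A * (G * ?T) * A = A" using A G 1 by (simp add: assoc_mult_mat_dim)
  moreover have "G * ?T \<in> carrier_mat n m" using A G by auto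
  ultimately show ?thesis using that by blast
qed

text \<open>Inner inverses \<open>L\<close> and \<open>M\<close> with \<open>A * L\<close> and
  \<open>M * A\<close> symmetric combine into \<open>X = M * A * L\<close>, for which
  \<open>A * X = A * L\<close> and \<open>X * A = M * A\<close>. The factor \<open>M\<close> is the
  transpose of the inverse \<open>K\<close> built for the transpose of \<open>A\<close>.\<close>

lemma moore_penrose_exists: "\<exists>X. is_moore_penrose A X"
proof -
  define m n where "m = dim_row A" and "n = dim_col A"
  have A: "A \<in> carrier_mat m n" by (auto simp: m_def n_def)
  obtain L where L: "L \<in> carrier_mat n m" "A * L * A = A" "transpose_mat (A * L) = A * L"
    using left_symmetric_inverse_exists[OF A] .
  let ?T = "transpose_mat A"
  obtain K where K: "K \<in> carrier_mat m n" "?T * K * ?T = ?T" "transpose_mat (?T * K) = ?T * K"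
    using left_symmetric_inverse_exists[of ?T n m] A by auto
  define M where "M = transpose_mat K"
  have M: "M \<in> carrier_mat n m" using K by (simp add: M_def)
  have "transpose_mat (?T * K * ?T) = A" by (simp only: K) simp
  then have "A * (transpose_mat K * A) = A" using A K(1) by (simp add: transpose_mult_dim)
  then have AMA: "A * (M * A) = A" by (simp only: M_def)
  have "M * A = ?T * K" using K A by (simp add: transpose_mult_dim M_def)
  then have MA: "transpose_mat (M * A) = M * A" using K by simp
  have ALA: "A * (L * A) = A" using A L by (simp add: assoc_mult_mat_dim)
  let ?X = "M * (A * L)"
  have AX: "A * ?X = A * L"
  proof -
    have "A * ?X = A * (M * A) * L" using A L M by (simp add: assoc_mult_mat_dim)
    then show ?thesis by (simp only: AMA)
  qed
  have XA: "?X * A = M * A"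
    using A L M ALA by (simp add: assoc_mult_mat_dim)
  have "A * ?X * A = A" using AX L by simp
  moreover have "?X * A * ?X = ?X"
  proof -
    have "?X * A * ?X = M * (A * ?X)" using A L M by (simp only: XA) (simp add: assoc_mult_mat_dim)
    then show ?thesis by (simp only: AX)
  qed
  ultimately have "is_moore_penrose A ?X"
    unfolding is_moore_penrose_def using A L M AX XA MA by auto
  then show ?thesis by blast
qed

text \<open>The products \<open>A * Y * A * X = A * X\<close> and
  \<open>A * X * A * Y = A * Y\<close> are transposes of each other, so symmetry identifies
  \<open>A * X\<close> with \<open>A * Y\<close>. Likewise \<open>X * A = Y * A\<close>, and then
  \<open>X = X * A * Y = Y\<close>.\<close>

lemma moore_penrose_unique:
  assumes "is_moore_penrose A X" "is_moore_penrose A Y"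
  shows "X = Y"
proof -
  note d = assms[unfolded is_moore_penrose_def]
  have X: "dim_row X = dim_col A" "dim_col X = dim_row A"
    and Y: "dim_row Y = dim_col A" "dim_col Y = dim_row A" using d by auto
  have "A * X = A * Y * (A * X)" using d X Y by (metis assoc_mult_mat_dim index_mult_mat(3))
  also have "\<dots> = transpose_mat (A * X * (A * Y))" using d X Y by (simp add: transpose_mult_dim)
  also have "A * X * (A * Y) = A * Y" using d X Y by (metis assoc_mult_mat_dim index_mult_mat(3))
  finally have AX: "A * X = A * Y" using d by simp
  have "X * A = X * A * (Y * A)" using d X Y
    by (metis assoc_mult_mat_dim index_mult_mat(2,3))
  also have "\<dots> = transpose_mat (Y * A * (X * A))" using d X Y by (simp add: transpose_mult_dim)
  also have "Y * A * (X * A) = Y * A" using d X Y by (metis assoc_mult_mat_dim index_mult_mat(2,3))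
  finally have XA: "X * A = Y * A" using d by simp
  have "X = X * (A * X)" using d X by (simp add: assoc_mult_mat_dim)
  also have "\<dots> = X * A * Y" using X Y AX by (simp add: assoc_mult_mat_dim)
  also have "\<dots> = Y" using XA d by simp
  finally show ?thesis .
qed

lemma pinv_moore_penrose: "is_moore_penrose A (pinv A)"
  unfolding pinv_def
  using moore_penrose_exists moore_penrose_unique by (metis theI')

lemma pinv_carrier: "A \<in> carrier_mat m n \<Longrightarrow> pinv A \<in> carrier_mat n m"
  and mult_pinv_mult: "A * pinv A * A = A"
  and pinv_mult_pinv: "pinv A * A * pinv A = pinv A"
  and transpose_pinv_mult: "transpose_mat (pinv A * A) = pinv A * A"
  using pinv_moore_penrose[of A] by (auto simp: is_moore_penrose_def)

section \<open>Absorption of projectors under range and kernel inclusion\<close>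

text \<open>The projector \<open>A * pinv A\<close> fixes every vector \<open>A x\<close>, and each
  \<open>P v\<close> has this form.\<close>

lemma mult_pinv_absorb:
  assumes A: "A \<in> carrier_mat m n" and P: "P \<in> carrier_mat m k"
    and sub: "mat_range P \<subseteq> mat_range A"
  shows "A * pinv A * P = P"
proof (rule mat_eq_if_mult_vec_eq[OF _ P])
  note X = pinv_carrier[OF A]
  fix v :: "real vec" assume v: "v \<in> carrier_vec k"
  then have "P *\<^sub>v v \<in> mat_range A" using sub P by (auto simp: mat_range_def)
  then obtain x where x: "x \<in> carrier_vec n" "P *\<^sub>v v = A *\<^sub>v x" using A by (auto simp: mat_range_def)
  have "A * pinv A * P *\<^sub>v v = A * pinv A *\<^sub>v (A *\<^sub>v x)"
    using assoc_mult_mat_vec[of "A * pinv A" m m P k v] A P X v x by simp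
  also have "\<dots> = A * pinv A * A *\<^sub>v x"
    by (rule assoc_mult_mat_vec[symmetric]) (use A X x in auto)
  finally show "A * pinv A * P *\<^sub>v v = P *\<^sub>v v" using x by (simp add: mult_pinv_mult)
qed (use A P pinv_carrier[OF A] in auto)

text \<open>Every \<open>v\<close> differs from \<open>pinv P * P v\<close> by a vector in the
  kernel of \<open>P\<close>, which \<open>A\<close> annihilates as well.\<close>

lemma mult_pinv_mult_absorb:
  assumes A: "A \<in> carrier_mat m n" and P: "P \<in> carrier_mat k n"
    and sub: "mat_kernel P \<subseteq> mat_kernel A"
  shows "A * (pinv P * P) = A"
proof (rule mat_eq_if_mult_vec_eq[OF _ A])
  note X = pinv_carrier[OF P]
  fix v :: "real vec" assume v: "v \<in> carrier_vec n"
  let ?w = "pinv P * P *\<^sub>v v"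
  have w: "?w \<in> carrier_vec n" using P X v by auto
  have "P *\<^sub>v ?w = P * (pinv P * P) *\<^sub>v v"
    by (rule assoc_mult_mat_vec[symmetric]) (use P X v in auto)
  then have "P *\<^sub>v ?w = P *\<^sub>v v" using P X mult_pinv_mult[of P] by (simp add: assoc_mult_mat_dim)
  then have "P *\<^sub>v (v - ?w) = 0\<^sub>v k" using P v w by (simp add: mult_minus_distrib_mat_vec[OF P v w])
  then have "v - ?w \<in> mat_kernel P" using P v w by (auto simp: mat_kernel_def)
  then have "A *\<^sub>v (v - ?w) = 0\<^sub>v m" using sub A by (auto simp: mat_kernel_def)
  then have 0: "A *\<^sub>v v - A *\<^sub>v ?w = 0\<^sub>v m" by (simp add: mult_minus_distrib_mat_vec[OF A v w])
  have "A *\<^sub>v ?w = A *\<^sub>v v"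
  proof (intro eq_vecI)
    fix i assume "i < dim_vec (A *\<^sub>v v)"
    moreover from this have "(A *\<^sub>v v - A *\<^sub>v ?w) $ i = 0" using A by (simp only: 0) simp
    ultimately show "(A *\<^sub>v ?w) $ i = (A *\<^sub>v v) $ i" using A by simp
  qed (use A in auto)
  then show "A * (pinv P * P) *\<^sub>v v = A *\<^sub>v v"
    using A P X v by (simp add: assoc_mult_mat_vec[of _ m n _ n])
qed (use A P pinv_carrier[OF P] in auto)

section \<open>Spectral radius of nonnegative matrices\<close>

text \<open>Passing to coordinates, with vectors as functions of which only the values below
  \<open>n\<close> count, lets the later estimates work on plain sums.\<close>

lemma eigenvalue_of_real_iff:
  fixes A :: "real mat"
  assumes A: "A \<in> carrier_mat n n"
  shows "eigenvalue (map_mat complex_of_real A) \<mu> \<longleftrightarrow>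
    (\<exists>v. (\<exists>i<n. v i \<noteq> 0) \<and> (\<forall>i<n. (\<Sum>j = 0..<n. of_real (A $$ (i,j)) * v j) = \<mu> * v i))"
    (is "?L \<longleftrightarrow> ?R")
proof
  assume ?L
  then obtain v where v: "eigenvector (map_mat complex_of_real A) v \<mu>" by (auto simp: eigenvalue_def)
  then have dv: "v \<in> carrier_vec n" and v0: "v \<noteq> 0\<^sub>v n"
    and eq: "map_mat complex_of_real A *\<^sub>v v = \<mu> \<cdot>\<^sub>v v"
    using A by (auto simp: eigenvector_def)
  have "\<exists>i<n. v $ i \<noteq> 0" using v0 dv by (metis carrier_vecD eq_vecI index_zero_vec)
  moreover have "(\<Sum>j = 0..<n. of_real (A $$ (i,j)) * v $ j) = \<mu> * v $ i" if i: "i < n" for i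
  proof -
    have "(\<Sum>j = 0..<n. of_real (A $$ (i,j)) * v $ j) = (map_mat complex_of_real A *\<^sub>v v) $ i"
      using A dv i by (auto simp: scalar_prod_def intro!: sum.cong)
    then show ?thesis using eq dv i by simp
  qed
  ultimately show ?R by (intro exI[of _ "($) v"]) auto
next
  assume ?R
  then obtain v k where v: "k < n" "v k \<noteq> 0"
    "\<And>i. i < n \<Longrightarrow> (\<Sum>j = 0..<n. of_real (A $$ (i,j)) * v j) = \<mu> * v i" by auto
  have "eigenvector (map_mat complex_of_real A) (vec n v) \<mu>"
    unfolding eigenvector_def
  proof (intro conjI)
    have "vec n v $ k \<noteq> 0\<^sub>v n $ k" using v by simp
    then show "vec n v \<noteq> 0\<^sub>v (dim_row (map_mat complex_of_real A))" using A by auto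
    show "map_mat complex_of_real A *\<^sub>v vec n v = \<mu> \<cdot>\<^sub>v vec n v"
    proof (intro eq_vecI)
      fix i assume "i < dim_vec (\<mu> \<cdot>\<^sub>v vec n v)"
      then have i: "i < n" by simp
      have "(map_mat complex_of_real A *\<^sub>v vec n v) $ i = (\<Sum>j = 0..<n. of_real (A $$ (i,j)) * v j)"
        using A i by (auto simp: scalar_prod_def intro!: sum.cong)
      then show "(map_mat complex_of_real A *\<^sub>v vec n v) $ i = (\<mu> \<cdot>\<^sub>v vec n v) $ i"
        using v(3)[OF i] i by simp
    qed (use A in auto)
  qed (use A in auto)
  then show ?L by (auto simp: eigenvalue_def)
qed

lemma norm_eigenvalue_le:
  assumes A: "A \<in> carrier_mat n n" and e: "eigenvalue (map_mat complex_of_real A) \<mu>"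
  shows "norm \<mu> \<le> real_spectral_radius A"
proof -
  have A': "map_mat complex_of_real A \<in> carrier_mat n n" using A by auto
  show ?thesis unfolding real_spectral_radius_def
    by (rule spectral_radius_mem_max(2)[OF A'])
      (use eigenvalue_imp_nonzero_dim[OF A' e] e in \<open>auto simp: spectrum_def\<close>)
qed

lemma real_spectral_radius_attained:
  assumes A: "A \<in> carrier_mat n n" and n: "n > 0"
  obtains \<mu> where "eigenvalue (map_mat complex_of_real A) \<mu>" "norm \<mu> = real_spectral_radius A"
proof -
  have "map_mat complex_of_real A \<in> carrier_mat n n" using A by auto
  from spectral_radius_mem_max(1)[OF this n] that show ?thesis
    by (auto simp: spectrum_def real_spectral_radius_def)
qed

section \<open>Positive vectors as certificates for spectral radius bounds\<close>

text \<open>This is the Collatz-Wielandt upper bound: for an eigenvector \<open>v\<close> whose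
  eigenvalue attains the spectral radius, moduli are compared in the row where
  \<open>norm (v i) / z i\<close> is largest.\<close>

lemma real_spectral_radius_less:
  fixes A :: "real mat"
  assumes A: "A \<in> carrier_mat n n" and n: "n > 0" and nonneg: "0\<^sub>m n n \<le> A"
    and z: "\<And>i. i < n \<Longrightarrow> z i > 0"
    and less: "\<And>i. i < n \<Longrightarrow> (\<Sum>j = 0..<n. A $$ (i,j) * z j) < c * z i"
  shows "real_spectral_radius A < c"
proof -
  have A0: "A $$ (i,j) \<ge> 0" if "i < n" "j < n" for i j
    using nonneg that A by (auto simp: less_eq_mat_def)
  obtain \<mu> where \<mu>: "eigenvalue (map_mat complex_of_real A) \<mu>" "norm \<mu> = real_spectral_radius A"
    using real_spectral_radius_attained[OF A n] .
  then obtain v k where v: "k < n" "v k \<noteq> 0"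
    "\<And>i. i < n \<Longrightarrow> (\<Sum>j = 0..<n. of_real (A $$ (i,j)) * v j) = \<mu> * v i"
    unfolding eigenvalue_of_real_iff[OF A] by auto
  define q where "q i = norm (v i) / z i" for i
  have "Max (q ` {0..<n}) \<in> q ` {0..<n}" by (rule Max_in) (use n in auto)
  then obtain i where i: "i < n" "q i = Max (q ` {0..<n})" by auto
  have max: "q j \<le> q i" if "j < n" for j using i that by auto
  \<comment> \<open>Since \<open>v\<close> is nonzero, the maximal ratio is positive, and the strict
    inequality survives multiplication by it.\<close>
  have "q k > 0" using v z by (simp add: q_def)
  then have qi: "q i > 0" using max[OF v(1)] by simp
  have vq: "norm (v j) = q j * z j" if "j < n" for j using z[OF that] by (simp add: q_def)
  have "norm \<mu> * norm (v i) = norm (\<Sum>j = 0..<n. of_real (A $$ (i,j)) * v j)"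
    using v(3)[OF i(1)] by (simp add: norm_mult)
  also have "\<dots> \<le> (\<Sum>j = 0..<n. A $$ (i,j) * norm (v j))"
    by (rule order.trans[OF norm_sum]) (use A0 i in \<open>auto simp: norm_mult intro!: sum_mono\<close>)
  also have "\<dots> \<le> (\<Sum>j = 0..<n. A $$ (i,j) * (q i * z j))"
    using A0 i max z by (intro sum_mono mult_left_mono) (auto simp: vq intro!: mult_right_mono less_imp_le)
  also have "\<dots> = q i * (\<Sum>j = 0..<n. A $$ (i,j) * z j)"
    by (simp add: sum_distrib_left algebra_simps)
  also have "\<dots> < q i * (c * z i)" using less[OF i(1)] qi by simp
  also have "\<dots> = c * norm (v i)" using vq[OF i(1)] by simp
  finally have "norm \<mu> < c" using qi z[OF i(1)] vq[OF i(1)] by simp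
  then show ?thesis using \<mu> by simp
qed

lemma pow_mat_Suc_left:
  fixes A :: "'a :: semiring_1 mat"
  assumes A: "A \<in> carrier_mat n n"
  shows "A ^\<^sub>m Suc k = A * A ^\<^sub>m k"
proof (induction k)
  case 0
  show ?case using A by simp
next
  case (Suc k)
  then have "A ^\<^sub>m Suc (Suc k) = A * A ^\<^sub>m k * A" by simp
  also have "\<dots> = A * A ^\<^sub>m Suc k" using A by (simp add: assoc_mult_mat_dim)
  finally show ?case .
qed

text \<open>With \<open>D = A / c\<close>, the vector \<open>z = e + D e + \<dots> + D\<^sup>N\<^sup>-\<^sup>1 e\<close> satisfies
  \<open>D z = z - e + D\<^sup>N e\<close>, and the powers of \<open>D\<close> tend to zero.\<close>

lemma subinvariant_vector_exists:
  fixes A :: "real mat"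
  assumes A: "A \<in> carrier_mat n n" and n: "n > 0" and nonneg: "0\<^sub>m n n \<le> A"
    and less: "real_spectral_radius A < c"
  obtains z where "\<And>i. i < n \<Longrightarrow> z i > 0"
    "\<And>i. i < n \<Longrightarrow> (\<Sum>j = 0..<n. A $$ (i,j) * z j) < c * z i"
proof -
  have A0: "A $$ (i,j) \<ge> 0" if "i < n" "j < n" for i j
    using nonneg that A by (auto simp: less_eq_mat_def)
  have r0: "real_spectral_radius A \<ge> 0"
    by (rule real_spectral_radius_attained[OF A n]) (metis norm_ge_zero)
  \<comment> \<open>The powers of \<open>B = A / c'\<close> will be bounded; the gap between
    \<open>c'\<close> and \<open>c\<close> then makes the powers of \<open>A / c = s B\<close> decay
    geometrically.\<close>
  define c' where "c' = (real_spectral_radius A + c) / 2"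
  have c': "real_spectral_radius A < c'" "0 < c'" "c' < c" using less r0 by (auto simp: c'_def)
  define s where "s = c' / c"
  have s: "0 < s" "s < 1" using c' by (auto simp: s_def)
  define B where "B = (1 / c') \<cdot>\<^sub>m A"
  have B: "B \<in> carrier_mat n n" using A by (simp add: B_def)
  have AB: "A $$ (i,j) = c' * B $$ (i,j)" if "i < n" "j < n" for i j
    using that A c' by (simp add: B_def)
  have B0: "B $$ (i,j) \<ge> 0" if "i < n" "j < n" for i j
    using that A A0 c' by (simp add: B_def)
  have "real_spectral_radius B < 1"
  proof -
    obtain \<mu> where \<mu>: "eigenvalue (map_mat complex_of_real B) \<mu>" "norm \<mu> = real_spectral_radius B"
      using real_spectral_radius_attained[OF B n] .
    then obtain v k where v: "k < n" "v k \<noteq> 0"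
      "\<And>i. i < n \<Longrightarrow> (\<Sum>j = 0..<n. of_real (B $$ (i,j)) * v j) = \<mu> * v i"
      unfolding eigenvalue_of_real_iff[OF B] by auto
    have "(\<Sum>j = 0..<n. of_real (A $$ (i,j)) * v j) = (of_real c' * \<mu>) * v i" if i: "i < n" for i
    proof -
      have "(\<Sum>j = 0..<n. of_real (A $$ (i,j)) * v j) =
          of_real c' * (\<Sum>j = 0..<n. of_real (B $$ (i,j)) * v j)"
        using i by (simp add: AB sum_distrib_left mult.assoc)
      then show ?thesis using v(3)[OF i] by simp
    qed
    then have "eigenvalue (map_mat complex_of_real A) (of_real c' * \<mu>)"
      unfolding eigenvalue_of_real_iff[OF A] using v by blast
    from norm_eigenvalue_le[OF A this] have "norm (of_real c' * \<mu>) < c'" using c' by linarith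
    then show ?thesis using c' \<mu> by (simp add: norm_mult)
  qed
  \<comment> \<open>Through the Jordan normal form, one constant bounds all entries of all powers,
    because every eigenvalue has modulus less than 1.\<close>
  then obtain K where K: "\<And>k. norm_bound ((map_mat complex_of_real B) ^\<^sub>m k) K"
    using spectral_radius_jnf_norm_bound_less_1_upper_triangular[of "map_mat complex_of_real B" n] B
    by (auto simp: real_spectral_radius_def)
  have BK: "(B ^\<^sub>m k) $$ (i,j) \<le> K" if "i < n" "j < n" for i j k
  proof -
    have "(map_mat complex_of_real B) ^\<^sub>m k = map_mat complex_of_real (B ^\<^sub>m k)"
      by (rule of_real_hom.mat_hom_pow[OF B, symmetric])
    with K[of k] that B pow_carrier_mat[OF B, of k] have "norm (complex_of_real ((B ^\<^sub>m k) $$ (i,j))) \<le> K"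
      by (auto simp: norm_bound_def)
    then show ?thesis by simp
  qed
  \<comment> \<open>\<open>w k\<close> is the \<open>k\<close>-th power of \<open>B\<close> applied
    to the all-ones vector.\<close>
  define w where "w k i = (\<Sum>j = 0..<n. (B ^\<^sub>m k) $$ (i,j))" for k i
  have w_0: "w 0 i = 1" if "i < n" for i using that B by (simp add: w_def)
  have w_Suc: "w (Suc k) i = (\<Sum>j = 0..<n. B $$ (i,j) * w k j)" if i: "i < n" for i k
  proof -
    have "(B ^\<^sub>m Suc k) $$ (i,j) = (\<Sum>l = 0..<n. B $$ (i,l) * (B ^\<^sub>m k) $$ (l,j))" if "j < n" for j
      unfolding pow_mat_Suc_left[OF B]
      using i that B pow_carrier_mat[OF B, of k] by (auto simp: scalar_prod_def intro!: sum.cong)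
    then have "w (Suc k) i = (\<Sum>j = 0..<n. \<Sum>l = 0..<n. B $$ (i,l) * (B ^\<^sub>m k) $$ (l,j))"
      by (simp add: w_def)
    also have "\<dots> = (\<Sum>j = 0..<n. B $$ (i,j) * w k j)"
      by (subst sum.swap) (simp add: w_def sum_distrib_left)
    finally show ?thesis .
  qed
  have w_nonneg: "w k i \<ge> 0" if "i < n" for k i
    using that by (induction k arbitrary: i) (auto simp: w_0 w_Suc B0 intro!: sum_nonneg)
  have w_le: "w k i \<le> real n * K" if "i < n" for k i
    using sum_bounded_above[of "{0..<n}" "\<lambda>j. (B ^\<^sub>m k) $$ (i,j)" K] BK that by (simp add: w_def)
  have "(\<lambda>N. s ^ N * (real n * K)) \<longlonglongrightarrow> 0 * (real n * K)"
    using s by (intro tendsto_intros LIMSEQ_realpow_zero) auto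
  then have "\<forall>\<^sub>F N in sequentially. s ^ N * (real n * K) < 1"
    by (rule order_tendstoD) simp
  with eventually_ge_at_top[of 1]
  have "\<forall>\<^sub>F N in sequentially. N \<ge> 1 \<and> s ^ N * (real n * K) < 1" by eventually_elim simp
  then obtain N where N: "s ^ N * (real n * K) < 1" "N \<ge> 1"
    using eventually_happens'[OF sequentially_bot] by blast
  define z where "z i = (\<Sum>k<N. s ^ k * w k i)" for i
  show ?thesis
  proof
    fix i assume i: "i < n"
    \<comment> \<open>The term for \<open>k = 0\<close> is 1 and the others are nonnegative;
      \<open>N \<ge> 1\<close> ensures that this term occurs.\<close>
    have "s ^ 0 * w 0 i \<le> z i"
      unfolding z_def using N s w_nonneg[OF i] by (intro member_le_sum) auto
    then show "z i > 0" using w_0[OF i] by simp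
    have "(\<Sum>j = 0..<n. A $$ (i,j) * z j) = (\<Sum>k<N. \<Sum>j = 0..<n. A $$ (i,j) * (s ^ k * w k j))"
      unfolding z_def sum_distrib_left by (rule sum.swap)
    also have "\<dots> = (\<Sum>k<N. c' * s ^ k * w (Suc k) i)"
      using i by (simp add: w_Suc AB sum_distrib_left algebra_simps)
    also have "\<dots> = c * (\<Sum>k<N. s ^ Suc k * w (Suc k) i)"
      using c' by (simp add: s_def sum_distrib_left)
    \<comment> \<open>Shifting the summation index loses the initial term 1 and adds
      \<open>s ^ N * w N i\<close>, which \<open>N\<close> was chosen to keep below 1.\<close>
    also have "(\<Sum>k<N. s ^ Suc k * w (Suc k) i) = z i - 1 + s ^ N * w N i"
      using sum_lessThan_telescope[of "\<lambda>k. s ^ k * w k i" N] w_0[OF i]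
      by (simp add: z_def sum_subtractf)
    also have "c * (z i - 1 + s ^ N * w N i) < c * z i"
    proof -
      have "s ^ N * w N i \<le> s ^ N * (real n * K)" using w_le[OF i] s by (intro mult_left_mono) auto
      then have "z i - 1 + s ^ N * w N i < z i" using N by simp
      then show ?thesis using c' by simp
    qed
    finally show "(\<Sum>j = 0..<n. A $$ (i,j) * z j) < c * z i" .
  qed
qed

text \<open>A positive certificate for \<open>B\<close> at level \<open>c\<close> also certifies
  \<open>A\<close>; letting \<open>c\<close> decrease to the spectral radius of \<open>B\<close>
  gives the bound.\<close>

lemma real_spectral_radius_mono:
  fixes A B :: "real mat"
  assumes B: "B \<in> carrier_mat n n" and n: "n > 0" and nonneg: "0\<^sub>m n n \<le> A" and le: "A \<le> B"
  shows "real_spectral_radius A \<le> real_spectral_radius B"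
proof (rule dense_ge)
  fix c assume c: "real_spectral_radius B < c"
  have A: "A \<in> carrier_mat n n" using B le by (auto simp: less_eq_mat_def)
  have "0\<^sub>m n n \<le> B" using nonneg le by (rule order.trans)
  then obtain z where z: "\<And>i. i < n \<Longrightarrow> z i > 0"
    "\<And>i. i < n \<Longrightarrow> (\<Sum>j = 0..<n. B $$ (i,j) * z j) < c * z i"
    using subinvariant_vector_exists[OF B n _ c] by blast
  have "real_spectral_radius A < c"
  proof (rule real_spectral_radius_less[OF A n nonneg z(1)])
    fix i assume i: "i < n"
    have "(\<Sum>j = 0..<n. A $$ (i,j) * z j) \<le> (\<Sum>j = 0..<n. B $$ (i,j) * z j)"
      using le i B z(1) by (intro sum_mono mult_right_mono) (auto simp: less_eq_mat_def intro: less_imp_le)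
    then show "(\<Sum>j = 0..<n. A $$ (i,j) * z j) < c * z i" using z(2)[OF i] by simp
  qed
  then show "real_spectral_radius A \<le> c" by simp
qed

section \<open>Continuity of the spectral radius on nonnegative matrices\<close>

text \<open>Used in contrapositive form: if a monic polynomial of degree \<open>n\<close> has
  modulus below \<open>\<epsilon> ^ n\<close> at \<open>\<mu>\<close>, one of its roots is closer
  than \<open>\<epsilon>\<close> to \<open>\<mu>\<close>.\<close>

lemma norm_prod_list_ge_power:
  fixes \<mu> :: complex
  assumes "\<And>a. a \<in> set as \<Longrightarrow> norm (\<mu> - a) \<ge> \<epsilon>" "\<epsilon> \<ge> 0"
  shows "norm (poly (\<Prod>a\<leftarrow>as. [:- a, 1:]) \<mu>) \<ge> \<epsilon> ^ length as"
  using assms(1)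
proof (induction as)
  case (Cons a as)
  have "\<epsilon> * \<epsilon> ^ length as \<le> norm (\<mu> - a) * norm (poly (\<Prod>a\<leftarrow>as. [:- a, 1:]) \<mu>)"
    using Cons assms(2) by (intro mult_mono) auto
  then show ?case by (simp add: norm_mult[symmetric] algebra_simps)
qed simp

text \<open>By the Leibniz formula the determinant is a polynomial in the entries.\<close>

lemma tendsto_det:
  fixes f :: "'b \<Rightarrow> 'a :: {real_normed_algebra, comm_ring_1} mat"
  assumes "\<forall>\<^sub>F x in F. f x \<in> carrier_mat n n" and L: "L \<in> carrier_mat n n"
    and lim: "\<And>i j. i < n \<Longrightarrow> j < n \<Longrightarrow> ((\<lambda>x. f x $$ (i,j)) \<longlongrightarrow> L $$ (i,j)) F"
  shows "((\<lambda>x. det (f x)) \<longlongrightarrow> det L) F"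
proof (rule Lim_transform_eventually)
  show "((\<lambda>x. \<Sum>p \<in> {p. p permutes {0..<n}}. signof p * (\<Prod>i = 0..<n. f x $$ (i, p i))) \<longlongrightarrow> det L) F"
    unfolding det_def'[OF L]
    by (intro tendsto_intros tendsto_prod lim) (auto simp: permutes_in_image)
  show "\<forall>\<^sub>F x in F. (\<Sum>p \<in> {p. p permutes {0..<n}}. signof p * (\<Prod>i = 0..<n. f x $$ (i, p i))) = det (f x)"
    using assms(1) by eventually_elim (simp add: det_def')
qed

text \<open>At a fixed point \<open>\<mu>\<close> the value is the determinant of
  \<open>\<mu> I - A\<close>, whose entries converge.\<close>

lemma tendsto_char_poly:
  fixes f :: "'b \<Rightarrow> real mat"
  assumes ev: "\<forall>\<^sub>F x in F. f x \<in> carrier_mat n n" and L: "L \<in> carrier_mat n n"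
    and lim: "\<And>i j. i < n \<Longrightarrow> j < n \<Longrightarrow> ((\<lambda>x. f x $$ (i,j)) \<longlongrightarrow> L $$ (i,j)) F"
  shows "((\<lambda>x. poly (char_poly (map_mat complex_of_real (f x))) \<mu>) \<longlongrightarrow>
    poly (char_poly (map_mat complex_of_real L)) \<mu>) F"
proof (rule Lim_transform_eventually)
  let ?C = "\<lambda>A. - char_matrix (map_mat complex_of_real A) \<mu>"
  show "\<forall>\<^sub>F x in F. det (?C (f x)) = poly (char_poly (map_mat complex_of_real (f x))) \<mu>"
    using ev by eventually_elim (rule char_poly_matrix[symmetric], auto)
  have entry: "?C A $$ (i,j) = (if i = j then \<mu> else 0) - of_real (A $$ (i,j))"
    if "A \<in> carrier_mat n n" "i < n" "j < n" for A i j
    using that by (auto simp: char_matrix_def)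
  have "((\<lambda>x. det (?C (f x))) \<longlongrightarrow> det (?C L)) F"
  proof (rule tendsto_det)
    show "\<forall>\<^sub>F x in F. ?C (f x) \<in> carrier_mat n n" using ev by eventually_elim auto
    show "?C L \<in> carrier_mat n n" using L by auto
    fix i j assume ij: "i < n" "j < n"
    have "((\<lambda>x. (if i = j then \<mu> else 0) - of_real (f x $$ (i,j))) \<longlongrightarrow> ?C L $$ (i,j)) F"
      unfolding entry[OF L ij] by (intro tendsto_intros lim ij)
    then show "((\<lambda>x. ?C (f x) $$ (i,j)) \<longlongrightarrow> ?C L $$ (i,j)) F"
      by (rule Lim_transform_eventually) (use ev in eventually_elim, simp add: entry ij)
  qed
  also have "det (?C L) = poly (char_poly (map_mat complex_of_real L)) \<mu>"
    by (rule char_poly_matrix[symmetric]) (use L in auto)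
  finally show "((\<lambda>x. det (?C (f x))) \<longlongrightarrow> poly (char_poly (map_mat complex_of_real L)) \<mu>) F" .
qed

lemma tendsto_real_spectral_radius_nonneg:
  fixes f :: "'b \<Rightarrow> real mat"
  assumes ev: "\<forall>\<^sub>F x in F. 0\<^sub>m n n \<le> f x" and n: "n > 0" and L0: "0\<^sub>m n n \<le> L"
    and lim: "\<And>i j. i < n \<Longrightarrow> j < n \<Longrightarrow> ((\<lambda>x. f x $$ (i,j)) \<longlongrightarrow> L $$ (i,j)) F"
  shows "((\<lambda>x. real_spectral_radius (f x)) \<longlongrightarrow> real_spectral_radius L) F"
proof (rule order_tendstoI)
  have L: "L \<in> carrier_mat n n" using L0 by (auto simp: less_eq_mat_def)
  have evc: "\<forall>\<^sub>F x in F. f x \<in> carrier_mat n n"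
    using ev by eventually_elim (auto simp: less_eq_mat_def)
  {
    fix c assume "real_spectral_radius L < c"
    then obtain z where z: "\<And>i. i < n \<Longrightarrow> z i > 0"
      "\<And>i. i < n \<Longrightarrow> (\<Sum>j = 0..<n. L $$ (i,j) * z j) < c * z i"
      using subinvariant_vector_exists[OF L n L0] by blast
    have "\<forall>\<^sub>F x in F. (\<Sum>j = 0..<n. f x $$ (i,j) * z j) < c * z i" if i: "i < n" for i
      by (rule order_tendstoD(2)[OF _ z(2)[OF i]], rule tendsto_sum, rule tendsto_mult_right, rule lim)
        (use i in auto)
    then have "\<forall>\<^sub>F x in F. \<forall>i\<in>{..<n}. (\<Sum>j = 0..<n. f x $$ (i,j) * z j) < c * z i"
      by (subst eventually_ball_finite_distrib) auto
    with ev evc show "\<forall>\<^sub>F x in F. real_spectral_radius (f x) < c"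
      by eventually_elim (auto intro!: real_spectral_radius_less[OF _ n _ z(1)])
  next
    fix c assume c: "c < real_spectral_radius L"
    obtain \<mu> where \<mu>: "eigenvalue (map_mat complex_of_real L) \<mu>" "norm \<mu> = real_spectral_radius L"
      using real_spectral_radius_attained[OF L n] .
    \<comment> \<open>With this choice, every root within distance \<open>\<epsilon>\<close> of
      \<open>\<mu>\<close> has modulus greater than \<open>c\<close>.\<close>
    define \<epsilon> where "\<epsilon> = norm \<mu> - c"
    have \<epsilon>: "\<epsilon> > 0" using c \<mu> by (simp add: \<epsilon>_def)
    have "poly (char_poly (map_mat complex_of_real L)) \<mu> = 0"
      using \<mu> L by (subst eigenvalue_root_char_poly[symmetric, of _ n]) auto
    then have "((\<lambda>x. poly (char_poly (map_mat complex_of_real (f x))) \<mu>) \<longlongrightarrow> 0) F"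
      using tendsto_char_poly[OF evc L lim, of \<mu>] by simp
    then have "\<forall>\<^sub>F x in F. norm (poly (char_poly (map_mat complex_of_real (f x))) \<mu>) < \<epsilon> ^ n"
      using \<epsilon> by (auto simp: tendsto_iff)
    with evc show "\<forall>\<^sub>F x in F. c < real_spectral_radius (f x)"
    proof eventually_elim
      case (elim x)
      then have cx: "map_mat complex_of_real (f x) \<in> carrier_mat n n" by auto
      obtain as where as: "char_poly (map_mat complex_of_real (f x)) = (\<Prod>a\<leftarrow>as. [:- a, 1:])"
        "length as = n"
        using char_poly_factorized[OF cx] by auto
      have "\<not> \<epsilon> ^ n \<le> norm (poly (\<Prod>a\<leftarrow>as. [:- a, 1:]) \<mu>)" using elim as by simp
      then obtain a where a: "a \<in> set as" "norm (\<mu> - a) < \<epsilon>"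
        using norm_prod_list_ge_power[of as \<epsilon> \<mu>] as(2) \<epsilon> by force
      have "eigenvalue (map_mat complex_of_real (f x)) a"
        unfolding eigenvalue_root_char_poly[OF cx] as(1) by (rule linear_poly_root[OF a(1)])
      then have "norm a \<le> real_spectral_radius (f x)" using elim by (intro norm_eigenvalue_le) auto
      moreover have "norm \<mu> \<le> norm (\<mu> - a) + norm a"
        using norm_triangle_ineq[of "\<mu> - a" a] by simp
      ultimately show ?case using a(2) by (simp add: \<epsilon>_def)
    qed
  }
qed

section \<open>Double splittings\<close>

lemma nonneg_mat_iff:
  "0\<^sub>m m n \<le> X \<longleftrightarrow> X \<in> carrier_mat m n \<and> (\<forall>i<m. \<forall>j<n. 0 \<le> X $$ (i,j))"
  for X :: "real mat"
  by (auto simp: less_eq_mat_def)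

lemma nonpos_mat_iff:
  "X \<le> 0\<^sub>m m n \<longleftrightarrow> X \<in> carrier_mat m n \<and> (\<forall>i<m. \<forall>j<n. X $$ (i,j) \<le> 0)"
  for X :: "real mat"
  by (auto simp: less_eq_mat_def)

lemma uminus_nonneg_mat_iff: "0\<^sub>m m n \<le> - X \<longleftrightarrow> X \<le> 0\<^sub>m m n"
  for X :: "real mat"
  by (auto simp: less_eq_mat_def)

lemma double_iteration_mat_carrier:
  "G \<in> carrier_mat n n \<Longrightarrow> H \<in> carrier_mat n n \<Longrightarrow>
    double_iteration_mat n G H \<in> carrier_mat (n + n) (n + n)"
  by (auto simp: double_iteration_mat_def)

lemma index_double_iteration_mat:
  assumes "G \<in> carrier_mat n n" "H \<in> carrier_mat n n" "i < n + n" "j < n + n"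
  shows "double_iteration_mat n G H $$ (i,j) =
    (if i < n then if j < n then G $$ (i,j) else - H $$ (i, j - n)
     else if j = i - n then 1 else 0)"
  using assms by (auto simp: double_iteration_mat_def)

lemma double_iteration_mat_nonneg:
  assumes "0\<^sub>m n n \<le> G" "H \<le> 0\<^sub>m n n"
  shows "0\<^sub>m (n + n) (n + n) \<le> double_iteration_mat n G H"
proof -
  have "G \<in> carrier_mat n n" "H \<in> carrier_mat n n" using assms by (auto simp: less_eq_mat_def)
  with assms double_iteration_mat_carrier[OF this] show ?thesis
    by (auto simp: less_eq_mat_def index_double_iteration_mat)
qed

lemma double_iteration_mat_mono:
  assumes "H' \<in> carrier_mat n n" "G' \<in> carrier_mat n n" "G \<le> G'" "H' \<le> H"
  shows "double_iteration_mat n G H \<le> double_iteration_mat n G' H'"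
proof -
  have "G \<in> carrier_mat n n" "H \<in> carrier_mat n n" using assms by (auto simp: less_eq_mat_def)
  with assms double_iteration_mat_carrier[OF this] double_iteration_mat_carrier[OF assms(2,1)]
  show ?thesis by (auto simp: less_eq_mat_def index_double_iteration_mat)
qed

text \<open>For the vector \<open>u\<close> with \<open>(G - H) u < u\<close>, the vector \<open>(u, (1 + \<epsilon>) u)\<close> is strictly decreased
  by the iteration matrix once \<open>\<epsilon>\<close> is small.\<close>

lemma real_spectral_radius_double_iteration_mat_less_1:
  assumes n: "n > 0" and G0: "0\<^sub>m n n \<le> G" and H0: "H \<le> 0\<^sub>m n n"
    and u: "\<And>i. i < n \<Longrightarrow> u i > 0"
    and less: "\<And>i. i < n \<Longrightarrow> (\<Sum>j = 0..<n. (G - H) $$ (i,j) * u j) < u i"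
  shows "real_spectral_radius (double_iteration_mat n G H) < 1"
proof -
  have G: "G \<in> carrier_mat n n" and H: "H \<in> carrier_mat n n"
    using G0 H0 by (auto simp: less_eq_mat_def)
  \<comment> \<open>The upper half of the image of \<open>(u, (1 + \<epsilon>) u)\<close> is
    \<open>a + \<epsilon> h\<close>, which tends to \<open>a < u\<close> as
    \<open>\<epsilon>\<close> decreases to 0.\<close>
  define a where "a i = (\<Sum>j = 0..<n. (G - H) $$ (i,j) * u j)" for i
  define h where "h i = (\<Sum>j = 0..<n. - H $$ (i,j) * u j)" for i
  have "\<forall>\<^sub>F \<epsilon> in at_right 0. a i + \<epsilon> * h i < u i" if i: "i < n" for i
  proof (rule order_tendstoD(2))
    show "((\<lambda>\<epsilon>. a i + \<epsilon> * h i) \<longlongrightarrow> a i + 0 * h i) (at_right 0)" by (intro tendsto_intros)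
    show "a i + 0 * h i < u i" using less[OF i] by (simp add: a_def)
  qed
  then have "\<forall>\<^sub>F \<epsilon> in at_right 0. \<forall>i\<in>{..<n}. a i + \<epsilon> * h i < u i"
    by (subst eventually_ball_finite_distrib) auto
  moreover have "\<forall>\<^sub>F \<epsilon> in at_right 0. (0::real) < \<epsilon>" by (rule eventually_at_right_less)
  ultimately have "\<forall>\<^sub>F \<epsilon> in at_right 0. 0 < \<epsilon> \<and> (\<forall>i\<in>{..<n}. a i + \<epsilon> * h i < u i)"
    by eventually_elim auto
  then obtain \<epsilon> where "0 < \<epsilon> \<and> (\<forall>i\<in>{..<n}. a i + \<epsilon> * h i < u i)"
    using eventually_happens'[OF trivial_limit_at_right_real] by blast
  then have \<epsilon>: "\<epsilon> > 0" "\<And>i. i < n \<Longrightarrow> a i + \<epsilon> * h i < u i" by auto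
  define z where "z i = (if i < n then u i else (1 + \<epsilon>) * u (i - n))" for i
  have z: "z i > 0" if "i < n + n" for i using that u \<epsilon> by (auto simp: z_def)
  show ?thesis
  proof (rule real_spectral_radius_less[OF double_iteration_mat_carrier[OF G H] _ _ z])
    show "0\<^sub>m (n + n) (n + n) \<le> double_iteration_mat n G H"
      by (rule double_iteration_mat_nonneg[OF G0 H0])
    let ?W = "double_iteration_mat n G H"
    fix i assume i: "i < n + n"
    have "(\<Sum>j = 0..<n + n. ?W $$ (i,j) * z j) =
        (\<Sum>j = 0..<n. ?W $$ (i,j) * z j) + (\<Sum>j = 0..<n. ?W $$ (i,j + n) * z (j + n))"
      using sum.atLeastLessThan_concat[of 0 n "n + n" "\<lambda>j. ?W $$ (i,j) * z j"]
        sum.shift_bounds_nat_ivl[of "\<lambda>j. ?W $$ (i,j) * z j" 0 n n] by simp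
    also have "\<dots> < 1 * z i"
    proof (cases "i < n")
      case True
      have "(\<Sum>j = 0..<n. ?W $$ (i,j) * z j) + (\<Sum>j = 0..<n. ?W $$ (i,j + n) * z (j + n)) =
          (\<Sum>j = 0..<n. G $$ (i,j) * u j) + (\<Sum>j = 0..<n. - H $$ (i,j) * ((1 + \<epsilon>) * u j))"
        using True G H by (simp add: index_double_iteration_mat z_def)
      also have "\<dots> = a i + \<epsilon> * h i"
        using True G H by (simp add: a_def h_def sum_distrib_left sum.distrib[symmetric] algebra_simps)
      finally show ?thesis using \<epsilon>(2)[OF True] True by (simp add: z_def)
    next
      case False
      \<comment> \<open>The lower half of the image is \<open>u\<close>, which is below
        \<open>(1 + \<epsilon>) u\<close>.\<close>
      have "(\<Sum>j = 0..<n. ?W $$ (i,j) * z j) + (\<Sum>j = 0..<n. ?W $$ (i,j + n) * z (j + n)) =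
          (\<Sum>j = 0..<n. (if j = i - n then 1 else 0) * u j)"
        using False G H i by (simp add: index_double_iteration_mat z_def)
      also have "\<dots> = (\<Sum>j = 0..<n. if j = i - n then u j else 0)"
        by (intro sum.cong) auto
      also have "\<dots> = u (i - n)" using False i by simp
      finally show ?thesis using False i u[of "i - n"] \<epsilon> by (simp add: z_def)
    qed
    finally show "(\<Sum>j = 0..<n + n. ?W $$ (i,j) * z j) < 1 * z i" .
  qed (use n in auto)
qed

text \<open>With \<open>T = P\<^sup>\<dagger>(P - A)\<close> and \<open>Q = A\<^sup>\<dagger>P\<close> one has \<open>T Q = Q - P\<^sup>\<dagger>P\<close> and
  \<open>T P\<^sup>\<dagger>P = T\<close>, so that \<open>u = T Q e + e\<close> satisfies \<open>T u = u - e\<close>.\<close>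

lemma proper_splitting_subinvariant_vector:
  fixes A P T :: "real mat"
  assumes A: "A \<in> carrier_mat m n" and P: "P \<in> carrier_mat m n"
    and range: "mat_range A = mat_range P" and ker: "mat_kernel A = mat_kernel P"
    and T_def: "T = pinv P * (P - A)" and T0: "0\<^sub>m n n \<le> T" and Q0: "0\<^sub>m n n \<le> pinv A * P"
  obtains u where "\<And>i. i < n \<Longrightarrow> u i \<ge> (1::real)"
    "\<And>i. i < n \<Longrightarrow> (\<Sum>j = 0..<n. T $$ (i,j) * u j) = u i - 1"
proof -
  define Q J where "Q = pinv A * P" and "J = pinv P * P"
  note A' = pinv_carrier[OF A] and P' = pinv_carrier[OF P]
  have T: "T \<in> carrier_mat n n" and Q: "Q \<in> carrier_mat n n" and J: "J \<in> carrier_mat n n"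
    using A P A' P' by (auto simp: T_def Q_def J_def)
  \<comment> \<open>Equality of the kernels yields \<open>A J = A\<close>; equality of the ranges
    yields \<open>A Q = P\<close>.\<close>
  have AJ: "A * J = A" unfolding J_def by (rule mult_pinv_mult_absorb[OF A P]) (simp add: ker)
  have PJ: "P * J = P" unfolding J_def by (rule mult_pinv_mult_absorb[OF P P]) simp
  have AQ: "A * Q = P"
    using mult_pinv_absorb[OF A P] range A A' P by (simp add: Q_def assoc_mult_mat_dim)
  \<comment> \<open>Both \<open>J\<close> and \<open>pinv A * A\<close> are symmetric, so
    transposing lets \<open>J\<close> act as a left identity on \<open>pinv A * A\<close>, and
    \<open>Q = pinv A * A * Q\<close> inherits this.\<close>
  have "J * (pinv A * A) = transpose_mat (pinv A * A * J)"
    using transpose_pinv_mult[of A] transpose_pinv_mult[of P] A A' P P'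
    by (subst transpose_mult_dim) (auto simp: J_def)
  also have "pinv A * A * J = pinv A * A" using AJ A A' P P' J by (simp add: assoc_mult_mat_dim)
  finally have "J * (pinv A * A) = pinv A * A" by (simp add: transpose_pinv_mult)
  then have "J * (pinv A * A) * (pinv A * P) = pinv A * A * (pinv A * P)" by simp
  moreover have "pinv A * A * (pinv A * P) = Q"
  proof -
    have "pinv A * A * (pinv A * P) = pinv A * A * pinv A * P"
      by (rule assoc_mult_mat_dim[symmetric]) (use A A' P in auto)
    then show ?thesis by (simp only: pinv_mult_pinv Q_def)
  qed
  moreover have "J * (pinv A * A) * (pinv A * P) = J * (pinv A * A * (pinv A * P))"
    by (rule assoc_mult_mat_dim) (use A A' P J in auto)
  ultimately have JQ: "J * Q = Q" by simp
  have T_eq: "T = J - pinv P * A"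
    unfolding T_def J_def by (rule mult_minus_distrib_mat) (use A P P' in auto)
  have "T * Q = J * Q - pinv P * A * Q"
    unfolding T_eq by (rule minus_mult_distrib_mat) (use J P' A Q in auto)
  also have "\<dots> = Q - J" using JQ AQ P' A Q by (simp add: assoc_mult_mat_dim J_def)
  finally have TQ: "T * Q = Q - J" .
  have "T * J = pinv P * ((P - A) * J)"
    using P' P A J by (simp add: T_def assoc_mult_mat_dim)
  also have "(P - A) * J = P - A"
    using minus_mult_distrib_mat[OF P A J] AJ PJ by simp
  finally have TJ: "T * J = T" by (simp add: T_def)
  have TT: "T * (T * Q) = T * Q - T"
    unfolding TQ using mult_minus_distrib_mat[OF T Q J] TJ TQ by simp
  \<comment> \<open>In \<open>T u\<close> the summand \<open>T e\<close> cancels against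
    \<open>T (T Q) e = T Q e - T e\<close>, leaving \<open>T Q e = u - e\<close>.\<close>
  define u where "u i = (\<Sum>k = 0..<n. (T * Q) $$ (i,k)) + 1" for i
  have TQ_nonneg: "(T * Q) $$ (i,k) \<ge> 0" if "i < n" "k < n" for i k
    using that T0 Q0 T Q
    by (subst index_mult_mat_sum) (auto simp: less_eq_mat_def Q_def intro!: sum_nonneg)
  show ?thesis
  proof
    fix i assume i: "i < n"
    show "u i \<ge> 1" using TQ_nonneg i by (auto simp: u_def intro!: sum_nonneg)
    have "(\<Sum>j = 0..<n. T $$ (i,j) * u j) =
        (\<Sum>j = 0..<n. \<Sum>k = 0..<n. T $$ (i,j) * (T * Q) $$ (j,k)) + (\<Sum>j = 0..<n. T $$ (i,j))"
      unfolding u_def by (simp add: distrib_left sum.distrib sum_distrib_left del: index_mult_mat)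
    also have "(\<Sum>j = 0..<n. \<Sum>k = 0..<n. T $$ (i,j) * (T * Q) $$ (j,k)) =
        (\<Sum>k = 0..<n. (T * (T * Q)) $$ (i,k))"
      using i T Q by (subst sum.swap) (auto simp: index_mult_mat_sum simp del: index_mult_mat(1))
    also have "\<dots> = (\<Sum>k = 0..<n. (T * Q) $$ (i,k) - T $$ (i,k))"
      unfolding TT using i T Q by (auto intro!: sum.cong simp del: index_mult_mat(1))
    finally show "(\<Sum>j = 0..<n. T $$ (i,j) * u j) = u i - 1"
      by (simp add: u_def sum_subtractf)
  qed
qed

section \<open>Inverses of the regularized factors and comparison in the limit\<close>

text \<open>\<open>minv\<close> has a known value only if \<open>mat_inverse\<close> succeeds;
  invertibility places \<open>B\<close> among the units of the matrix ring, which excludes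
  \<open>None\<close>.\<close>

lemma minv_carrier:
  assumes "B \<in> carrier_mat n n" "invertible_mat B"
  shows "minv B \<in> carrier_mat n n"
proof -
  obtain C where C: "inverts_mat B C" "inverts_mat C B"
    using assms by (auto simp: invertible_mat_def)
  \<comment> \<open>\<open>invertible_mat\<close> leaves the shape of the inverse open; the two
    identities determine it.\<close>
  have "dim_col (B * C) = dim_col (1\<^sub>m (dim_row B) :: real mat)"
    "dim_col (C * B) = dim_col (1\<^sub>m (dim_row C) :: real mat)"
    using C by (simp_all only: inverts_mat_def)
  then have "dim_row C = n" "dim_col C = n" using assms by auto
  then have "B \<in> Units (ring_mat TYPE(real) n ())"
    using C assms by (auto simp: Units_def ring_mat_def inverts_mat_def)
  then obtain X where "mat_inverse B = Some X"
    using mat_inverse(1)[OF assms(1), of "()"] by (cases "mat_inverse B") auto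
  then show ?thesis using mat_inverse(2)[OF assms(1)] by (simp add: minv_def)
qed

theorem theorem3p20:
  fixes m n :: nat
    and A P R S :: "real mat"
    and B\<^sub>l P\<^sub>l R\<^sub>l S\<^sub>l :: "real \<Rightarrow> real mat"
    and W :: "real mat" and W\<^sub>l :: "real \<Rightarrow> real mat"
  assumes "m > 0" and "n > 0"
    and "double_proper_weak_splitting_I m n A P R S"
    and "pinv A * P \<ge> 0\<^sub>m n n"
    and "\<And>l. l > 0 \<Longrightarrow> B\<^sub>l l = transpose_mat A * A + l \<cdot>\<^sub>m 1\<^sub>m n"
    and "\<And>l. l > 0 \<Longrightarrow> double_weak_splitting_I n (B\<^sub>l l) (P\<^sub>l l) (R\<^sub>l l) (S\<^sub>l l)"
    and "\<And>l. l > 0 \<Longrightarrow> minv (B\<^sub>l l) * P\<^sub>l l \<ge> 0\<^sub>m n n"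
    and "W = double_iteration_mat n (pinv P * R) (pinv P * S)"
    and "\<And>l. l > 0 \<Longrightarrow>
           W\<^sub>l l = double_iteration_mat n (minv (P\<^sub>l l) * R\<^sub>l l) (minv (P\<^sub>l l) * S\<^sub>l l)"
    and "(\<exists>L M. mat_tendsto (\<lambda>l. minv (P\<^sub>l l) * R\<^sub>l l) L (at_right 0) \<and>
                mat_tendsto (\<lambda>l. minv (P\<^sub>l l) * S\<^sub>l l) M (at_right 0) \<and>
                pinv P * R \<ge> L \<and> M \<ge> pinv P * S)
         \<or> pinv P * (R - S) \<ge> 1\<^sub>m n"
  shows "\<exists>r. ((\<lambda>l. real_spectral_radius (W\<^sub>l l)) \<longlongrightarrow> r) (at_right 0) \<and>
             r \<le> real_spectral_radius W \<and> real_spectral_radius W < 1"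
proof -
  note n = \<open>n > 0\<close>
  let ?G = "pinv P * R" and ?H = "pinv P * S"
  from assms(3) have A: "A \<in> carrier_mat m n" and P: "P \<in> carrier_mat m n"
    and R: "R \<in> carrier_mat m n" and S: "S \<in> carrier_mat m n" and dec: "A = P - R + S"
    and range: "mat_range A = mat_range P" and ker: "mat_kernel A = mat_kernel P"
    and G0: "0\<^sub>m n n \<le> ?G" and H0: "?H \<le> 0\<^sub>m n n"
    by (auto simp: double_proper_weak_splitting_I_def)
  note P' = pinv_carrier[OF P]
  have G: "?G \<in> carrier_mat n n" and H: "?H \<in> carrier_mat n n" using P' R S by auto
  \<comment> \<open>The splitting identity makes \<open>T = G - H\<close> equal to
    \<open>pinv P * (P - A)\<close>, the matrix for which the subinvariant vector is
    available.\<close>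
  have PA: "P - A = R - S" unfolding dec using P R S by (intro eq_matI) auto
  have T_eq: "pinv P * (R - S) = ?G - ?H" by (rule mult_minus_distrib_mat[OF P' R S])
  have "0\<^sub>m n n \<le> pinv P * (P - A)"
    unfolding PA T_eq using G0 H0 G H by (fastforce simp: less_eq_mat_def simp del: index_mult_mat(1))
  then obtain u where u: "\<And>i. i < n \<Longrightarrow> u i \<ge> 1"
    "\<And>i. i < n \<Longrightarrow> (\<Sum>j = 0..<n. (?G - ?H) $$ (i,j) * u j) = u i - 1"
    using proper_splitting_subinvariant_vector[OF A P range ker refl _ assms(4)]
    unfolding PA T_eq by blast
  have W_less: "real_spectral_radius W < 1"
    unfolding assms(8)
  proof (rule real_spectral_radius_double_iteration_mat_less_1[OF n G0 H0])
    fix i assume i: "i < n"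
    show "0 < u i" using u(1)[OF i] by simp
    show "(\<Sum>j = 0..<n. (?G - ?H) $$ (i,j) * u j) < u i" unfolding u(2)[OF i] by simp
  qed
  have "\<not> pinv P * (R - S) \<ge> 1\<^sub>m n"
  proof
    assume *: "pinv P * (R - S) \<ge> 1\<^sub>m n"
    \<comment> \<open>Coordinate 0 exists because \<open>n > 0\<close>; there
      \<open>T \<ge> I\<close> and \<open>u \<ge> 0\<close> would force
      \<open>u 0 \<le> (T u) 0 = u 0 - 1\<close>.\<close>
    have "u 0 = (\<Sum>j = 0..<n. 1\<^sub>m n $$ (0,j) * u j)"
      using n by (subst sum.remove[of _ 0]) auto
    also have "\<dots> \<le> (\<Sum>j = 0..<n. (?G - ?H) $$ (0,j) * u j)"
    proof (intro sum_mono mult_right_mono)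
      fix j assume j: "j \<in> {0..<n}"
      then show "1\<^sub>m n $$ (0,j) \<le> (?G - ?H) $$ (0,j)"
        using * n G H unfolding T_eq less_eq_mat_def
        by (auto simp del: index_mult_mat(1) index_minus_mat(1) index_one_mat(1))
      show "0 \<le> u j" using u(1)[of j] j by simp
    qed
    also have "\<dots> = u 0 - 1" using u(2) n by simp
    finally show False by simp
  qed
  with assms(10) obtain L M where
    L: "mat_tendsto (\<lambda>l. minv (P\<^sub>l l) * R\<^sub>l l) L (at_right 0)" and
    M: "mat_tendsto (\<lambda>l. minv (P\<^sub>l l) * S\<^sub>l l) M (at_right 0)" and
    LG: "L \<le> ?G" and HM: "?H \<le> M" by auto
  \<comment> \<open>The matrix order includes equality of dimensions, which fixes the shapes of the
    limits.\<close>
  have Lc: "L \<in> carrier_mat n n" and Mc: "M \<in> carrier_mat n n"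
    using LG HM G H unfolding less_eq_mat_def by (metis carrier_matD carrier_matI)+
  have pos: "\<forall>\<^sub>F l in at_right 0. (0::real) < l" by (rule eventually_at_right_less)
  have carr: "minv (P\<^sub>l l) * R\<^sub>l l \<in> carrier_mat n n" "minv (P\<^sub>l l) * S\<^sub>l l \<in> carrier_mat n n"
    and sgn: "0\<^sub>m n n \<le> minv (P\<^sub>l l) * R\<^sub>l l" "minv (P\<^sub>l l) * S\<^sub>l l \<le> 0\<^sub>m n n" if "l > 0" for l
  proof -
    note d = assms(6)[OF that, unfolded double_weak_splitting_I_def]
    then have "minv (P\<^sub>l l) \<in> carrier_mat n n" by (intro minv_carrier) auto
    with d show "minv (P\<^sub>l l) * R\<^sub>l l \<in> carrier_mat n n" "minv (P\<^sub>l l) * S\<^sub>l l \<in> carrier_mat n n"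
      by auto
    show "0\<^sub>m n n \<le> minv (P\<^sub>l l) * R\<^sub>l l" "minv (P\<^sub>l l) * S\<^sub>l l \<le> 0\<^sub>m n n"
      using d unfolding uminus_nonneg_mat_iff by blast+
  qed
  have L_lim: "((\<lambda>l. (minv (P\<^sub>l l) * R\<^sub>l l) $$ (i,j)) \<longlongrightarrow> L $$ (i,j)) (at_right 0)"
    and M_lim: "((\<lambda>l. (minv (P\<^sub>l l) * S\<^sub>l l) $$ (i,j)) \<longlongrightarrow> M $$ (i,j)) (at_right 0)"
    if "i < n" "j < n" for i j
    using L M Lc Mc that by (auto simp: mat_tendsto_def simp del: index_mult_mat(1))
  \<comment> \<open>Weak inequalities between entries survive the limit, since the filter is
    nontrivial.\<close>
  have L0: "0\<^sub>m n n \<le> L"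
    unfolding nonneg_mat_iff
  proof (intro conjI allI impI)
    fix i j assume ij: "i < n" "j < n"
    have "\<forall>\<^sub>F l in at_right 0. 0 \<le> (minv (P\<^sub>l l) * R\<^sub>l l) $$ (i,j)"
      using pos by eventually_elim (use sgn(1) ij in \<open>simp only: nonneg_mat_iff\<close>)
    then show "0 \<le> L $$ (i,j)" by (rule tendsto_lowerbound[OF L_lim[OF ij]]) simp
  qed (rule Lc)
  have M0: "M \<le> 0\<^sub>m n n"
    unfolding nonpos_mat_iff
  proof (intro conjI allI impI)
    fix i j assume ij: "i < n" "j < n"
    have "\<forall>\<^sub>F l in at_right 0. (minv (P\<^sub>l l) * S\<^sub>l l) $$ (i,j) \<le> 0"
      using pos by eventually_elim (use sgn(2) ij in \<open>simp only: nonpos_mat_iff\<close>)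
    then show "M $$ (i,j) \<le> 0" by (rule tendsto_upperbound[OF M_lim[OF ij]]) simp
  qed (rule Mc)
  let ?V = "double_iteration_mat n L M"
  have nn: "n + n > 0" using n by simp
  have V0: "0\<^sub>m (n + n) (n + n) \<le> ?V" by (rule double_iteration_mat_nonneg[OF L0 M0])
  have "((\<lambda>l. real_spectral_radius (W\<^sub>l l)) \<longlongrightarrow> real_spectral_radius ?V) (at_right 0)"
  proof (rule tendsto_real_spectral_radius_nonneg[OF _ nn V0])
    show "\<forall>\<^sub>F l in at_right 0. 0\<^sub>m (n + n) (n + n) \<le> W\<^sub>l l"
      using pos by eventually_elim (simp add: assms(9) double_iteration_mat_nonneg sgn)
    fix i j assume ij: "i < n + n" "j < n + n"
    \<comment> \<open>Convergence holds blockwise: the upper blocks converge by condition (i), the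
      lower ones are constant.\<close>
    have "((\<lambda>l. if i < n then if j < n then (minv (P\<^sub>l l) * R\<^sub>l l) $$ (i,j)
        else - (minv (P\<^sub>l l) * S\<^sub>l l) $$ (i, j - n) else if j = i - n then 1 else 0)
        \<longlongrightarrow> ?V $$ (i,j)) (at_right 0)"
      unfolding index_double_iteration_mat[OF Lc Mc ij]
      using ij L_lim[of i j] tendsto_minus[OF M_lim[of i "j - n"]]
      by (auto simp del: index_mult_mat(1))
    then show "((\<lambda>l. W\<^sub>l l $$ (i,j)) \<longlongrightarrow> ?V $$ (i,j)) (at_right 0)"
    proof (rule Lim_transform_eventually)
      show "\<forall>\<^sub>F l in at_right 0. (if i < n then if j < n then (minv (P\<^sub>l l) * R\<^sub>l l) $$ (i,j)
        else - (minv (P\<^sub>l l) * S\<^sub>l l) $$ (i, j - n) else if j = i - n then 1 else 0) = W\<^sub>l l $$ (i,j)"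
        using pos
        by eventually_elim (simp only: assms(9) index_double_iteration_mat[OF carr ij])
    qed
  qed
  \<comment> \<open>The limit is \<open>r = \<rho>(V)\<close>, and the inequalities in condition (i)
    say that \<open>V\<close> lies entrywise below \<open>W\<close>.\<close>
  moreover have "real_spectral_radius ?V \<le> real_spectral_radius W"
    unfolding assms(8)
    by (rule real_spectral_radius_mono[OF double_iteration_mat_carrier[OF G H] nn V0])
      (rule double_iteration_mat_mono[OF H G LG HM])
  ultimately show ?thesis using W_less by blast
qed

end
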